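(* For every positive integer $k$, $$RR(\mathcal{E}(k,3)) = \begin{cases} 4 & \text{if } k \leq 5 \text{ or } k=7,\\ 6 & \text{if } k \in\{8,11\},\\ 9 & \text{if } k \in \{6,9,10\} \text{ or } k \geq 12.\end{cases}$$
   Context: For a positive integer $k$ and an integer $j > -k$, $\mathcal{E}(k,j)$ denotes the equation $x+y+kz=(k+j)w$. A $2$-coloring of $[1,N]=\{1,2,\dots,N\}$ is a map $\chi:[1,N]\to\{0,1\}$; a solution $(x,y,z,w)$ with $x,y,z,w\in[1,N]$ (not necessarily distinct) is monochromatic if $\chi(x)=\chi(y)=\chi(z)=\chi(w)$. For an equation $\mathcal{E}$, $RR(\mathcal{E})$ denotes the minimum positive integer $N$ such that every $2$-coloring of $[1,N]$ admits a monochromatic solution to $\mathcal{E}$ in $[1,N]$. *)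

theory Defs
  imports Main "HOL-Library.FuncSet" "HOL-Library.Extended_Nat"
begin

type_synonym equation4 = "nat \<Rightarrow> nat \<Rightarrow> nat \<Rightarrow> nat \<Rightarrow> bool"

(* x + y + kz = (k + j)w, intended for k > 0 and j > -k; read over the integers since j may be negative. *)
definition eq_E :: "nat \<Rightarrow> int \<Rightarrow> equation4" where
  "eq_E k j x y z w \<longleftrightarrow> int x + int y + int k * int z = (int k + j) * int w"

definition has_mono_solution :: "equation4 \<Rightarrow> nat \<Rightarrow> (nat \<Rightarrow> nat) \<Rightarrow> bool" where
  "has_mono_solution E N \<chi> \<longleftrightarrow>
     (\<exists>x\<in>{1..N}. \<exists>y\<in>{1..N}. \<exists>z\<in>{1..N}. \<exists>w\<in>{1..N}.
        E x y z w \<and> \<chi> x = \<chi> y \<and> \<chi> y = \<chi> z \<and> \<chi> z = \<chi> w)"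

definition forces_mono :: "equation4 \<Rightarrow> nat \<Rightarrow> bool" where
  "forces_mono E N \<longleftrightarrow> (\<forall>\<chi> \<in> {1..N} \<rightarrow> {0, 1}. has_mono_solution E N \<chi>)"

(* The infimum in enat is an attained minimum when some N qualifies, and \<infinity> otherwise;
   an equation RR E = n with finite n thus includes the existence of the minimum. *)
definition RR :: "equation4 \<Rightarrow> enat" where
  "RR E = (INF N\<in>{N. 0 < N \<and> forces_mono E N}. enat N)"

lemma RR_eq_enat_iff:
  "RR E = enat n \<longleftrightarrow>
     0 < n \<and> forces_mono E n \<and> (\<forall>m. 0 < m \<and> forces_mono E m \<longrightarrow> n \<le> m)"
proof
  assume RR: "RR E = enat n"
  let ?S = "{N. 0 < N \<and> forces_mono E N}"
  have "enat ` ?S \<noteq> {}"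
    using RR unfolding RR_def Inf_enat_def by (metis enat.distinct(1))
  then have "Inf (enat ` ?S) \<in> enat ` ?S"
    unfolding Inf_enat_def by (metis LeastI equals0I)
  then have "n \<in> ?S"
    using RR by (auto simp: RR_def)
  moreover have "n \<le> m" if "m \<in> ?S" for m
    using RR INF_lower[OF that, of enat] by (simp add: RR_def)
  ultimately show "0 < n \<and> forces_mono E n \<and> (\<forall>m. 0 < m \<and> forces_mono E m \<longrightarrow> n \<le> m)"
    by blast
next
  assume "0 < n \<and> forces_mono E n \<and> (\<forall>m. 0 < m \<and> forces_mono E m \<longrightarrow> n \<le> m)"
  then show "RR E = enat n"
    unfolding RR_def by (intro antisym INF_lower INF_greatest) auto
qed

end

theory Submission
  imports Defs
begin

text \<open>
  Taking \<open>z = w\<close> turns any solution of \<open>x + y = 3 w\<close> into a solution of \<open>E(k,3)\<close>, for every \<open>k\<close>.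
  These solutions alone force the colour classes of a coloring without monochromatic solution to be
  initial parts of \<open>{1, 3, 4, 7}\<close> and \<open>{2, 5, 6, 8}\<close>, and leave no colour for \<open>9\<close>. Any other
  monochromatic solution of this coloring satisfies \<open>3 w - x - y = k (z - w)\<close> with \<open>z \<noteq> w\<close>,
  so it determines \<open>k\<close>; this occurs within \<open>[1,4]\<close> for \<open>k \<le> 5\<close> or \<open>k = 7\<close>, within \<open>[1,6]\<close> but not
  \<open>[1,5]\<close> for \<open>k = 8, 11\<close>, and within \<open>[1,8]\<close> for no other \<open>k\<close>.
\<close>

lemma has_mono_solution_mono:
  assumes "has_mono_solution E M \<chi>" "M \<le> N"
  shows "has_mono_solution E N \<chi>"
proof -
  have "{1..M} \<subseteq> {1..N}"
    using assms(2) by auto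
  then show ?thesis
    using assms(1) unfolding has_mono_solution_def by blast
qed

text \<open>A solution inside \<open>{1..m}\<close> persists in every longer interval, so one
  \<open>\<chi>\<close> without monochromatic solution on \<open>{1..n - 1}\<close> rules out all
  \<open>m < n\<close> at once.\<close>

lemma RR_eqI:
  assumes "0 < n" "forces_mono E n" "\<And>i. \<chi> i \<in> {0, 1}" "\<not> has_mono_solution E (n - 1) \<chi>"
  shows "RR E = enat n"
  unfolding RR_eq_enat_iff
proof (intro conjI allI impI)
  fix m assume m: "0 < m \<and> forces_mono E m"
  then have "has_mono_solution E m \<chi>"
    using assms(3) unfolding forces_mono_def by blast
  then show "n \<le> m"
    using has_mono_solution_mono[of E m \<chi> "n - 1"] assms(4) by (cases "m \<le> n - 1") auto
qed (use assms in auto)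

lemma no_mono_solution:
  assumes "\<not> has_mono_solution E N \<chi>" "S \<subseteq> {1..N}" "\<And>i. i \<in> S \<Longrightarrow> \<chi> i = c"
    "x \<in> S" "y \<in> S" "z \<in> S" "w \<in> S"
  shows "\<not> E x y z w"
proof
  assume "E x y z w"
  moreover have "\<chi> x = \<chi> y" "\<chi> y = \<chi> z" "\<chi> z = \<chi> w"
    using assms(3)[OF assms(4)] assms(3)[OF assms(5)] assms(3)[OF assms(6)] assms(3)[OF assms(7)]
    by simp_all
  ultimately show False
    using assms(1,2,4-7) unfolding has_mono_solution_def by blast
qed

lemma no_mono_triple:
  assumes "\<not> has_mono_solution (eq_E k 3) N \<chi>" "x + y = 3 * w"
    "x \<in> {1..N}" "y \<in> {1..N}" "w \<in> {1..N}" "\<chi> x = \<chi> y"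
  shows "\<chi> w \<noteq> \<chi> x"
proof
  assume "\<chi> w = \<chi> x"
  then have "\<chi> i = \<chi> w" if "i \<in> {x, y, w}" for i
    using assms(6) that by auto
  moreover have "eq_E k 3 x y w w"
    unfolding eq_E_def using arg_cong[OF assms(2), of int] by (simp add: algebra_simps)
  ultimately show False
    using no_mono_solution[OF assms(1), of "{x, y, w}" "\<chi> w" x y w w] assms(3-5) by blast
qed

text \<open>The sums \<open>1 + 2 = 3 * 1\<close>, \<open>3 + 3 = 3 * 2\<close> and
  \<open>4 + 2 = 3 * 2\<close> separate 2 from 1, 3 and 4; with only two colours, the last three
  then agree.\<close>

lemma coloring_four:
  assumes "\<chi> \<in> {1..N} \<rightarrow> {0, 1}" "4 \<le> N" "\<not> has_mono_solution (eq_E k 3) N \<chi>"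
  shows "\<chi> 2 \<noteq> \<chi> 1" "\<chi> 3 = \<chi> 1" "\<chi> 4 = \<chi> 1"
proof -
  have col: "\<chi> i = 0 \<or> \<chi> i = 1" if "i \<in> {1..N}" for i
    using assms(1) that by auto
  note triple = no_mono_triple[OF assms(3)]
  show n: "\<chi> 2 \<noteq> \<chi> 1"
  proof
    assume "\<chi> 2 = \<chi> 1"
    then show False
      using triple[of 1 2 1] assms(2) by simp
  qed
  have "\<chi> 3 \<noteq> \<chi> 2" "\<chi> 4 \<noteq> \<chi> 2"
    using triple[of 3 3 2] triple[of 4 2 2] assms(2) by auto
  then show "\<chi> 3 = \<chi> 1" "\<chi> 4 = \<chi> 1"
    using n col[of 1] col[of 2] col[of 3] col[of 4] assms(2) by auto
qed

lemma coloring_six: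
  assumes "\<chi> \<in> {1..N} \<rightarrow> {0, 1}" "6 \<le> N" "\<not> has_mono_solution (eq_E k 3) N \<chi>"
  shows "\<chi> 5 = \<chi> 2" "\<chi> 6 = \<chi> 2"
proof -
  have col: "\<chi> i = 0 \<or> \<chi> i = 1" if "i \<in> {1..N}" for i
    using assms(1) that by auto
  note triple = no_mono_triple[OF assms(3)]
  have c: "\<chi> 2 \<noteq> \<chi> 1" "\<chi> 3 = \<chi> 1" "\<chi> 4 = \<chi> 1"
    using coloring_four[OF assms(1) _ assms(3)] assms(2) by auto
  \<comment> \<open>In \<open>5 + 4 = 3 * 3\<close> and \<open>6 + 3 = 3 * 3\<close> all other
    entries have the colour of 1.\<close>
  have "\<chi> 5 \<noteq> \<chi> 1" "\<chi> 6 \<noteq> \<chi> 1"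
    using triple[of 5 4 3] triple[of 6 3 3] c assms(2) by auto
  then show "\<chi> 5 = \<chi> 2" "\<chi> 6 = \<chi> 2"
    using c col[of 1] col[of 2] col[of 5] col[of 6] assms(2) by auto
qed

lemma forces_mono_nine: "forces_mono (eq_E k 3) 9"
  unfolding forces_mono_def
proof (rule ballI, rule ccontr)
  fix \<chi> :: "nat \<Rightarrow> nat"
  assume \<chi>: "\<chi> \<in> {1..9} \<rightarrow> {0, 1}" and no: "\<not> has_mono_solution (eq_E k 3) 9 \<chi>"
  have col: "\<chi> i = 0 \<or> \<chi> i = 1" if "i \<in> {1..9}" for i
    using \<chi> that by auto
  note triple = no_mono_triple[OF no]
  have c: "\<chi> 2 \<noteq> \<chi> 1" "\<chi> 3 = \<chi> 1" "\<chi> 4 = \<chi> 1" "\<chi> 5 = \<chi> 2" "\<chi> 6 = \<chi> 2"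
    using coloring_four[OF \<chi> _ no] coloring_six[OF \<chi> _ no] by auto
  \<comment> \<open>\<open>9 + 3 = 3 * 4\<close> bars the colour of 1, and
    \<open>9 + 6 = 3 * 5\<close> that of 2.\<close>
  have "\<chi> 9 \<noteq> \<chi> 1" "\<chi> 9 \<noteq> \<chi> 2"
    using triple[of 9 3 4] triple[of 9 6 5] c by auto
  then show False
    using c(1) col[of 1] col[of 2] col[of 9] by auto
qed

lemma forces_mono_four:
  assumes "k \<in> {1, 2, 3, 4, 5, 7}"
  shows "forces_mono (eq_E k 3) 4"
  unfolding forces_mono_def
proof (rule ballI, rule ccontr)
  fix \<chi> :: "nat \<Rightarrow> nat"
  assume \<chi>: "\<chi> \<in> {1..4} \<rightarrow> {0, 1}" and no: "\<not> has_mono_solution (eq_E k 3) 4 \<chi>"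
  have col: "\<chi> i = \<chi> 1" if "i \<in> {1, 3, 4}" for i
    using that coloring_four[OF \<chi> _ no] by auto
  have none: "\<not> eq_E k 3 x y z w"
    if "x \<in> {1, 3, 4}" "y \<in> {1, 3, 4}" "z \<in> {1, 3, 4}" "w \<in> {1, 3, 4}"
    for x y z w
    by (rule no_mono_solution[OF no _ col that]) simp
  then show False
    \<comment> \<open>For \<open>z = 4\<close> and \<open>w = 3\<close> the equation reads
      \<open>k = 9 - x - y\<close>; the six pairs \<open>x\<close>, \<open>y\<close> give
      \<open>k\<close> = 1, 2, 3, 4, 5, 7 in this order.\<close>
    using assms none[of 4 4 4 3] none[of 3 4 4 3] none[of 3 3 4 3]
      none[of 1 4 4 3] none[of 1 3 4 3] none[of 1 1 4 3]
    by (auto simp: eq_E_def)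
qed

lemma forces_mono_six:
  assumes "k \<in> {8, 11}"
  shows "forces_mono (eq_E k 3) 6"
  unfolding forces_mono_def
proof (rule ballI, rule ccontr)
  fix \<chi> :: "nat \<Rightarrow> nat"
  assume \<chi>: "\<chi> \<in> {1..6} \<rightarrow> {0, 1}" and no: "\<not> has_mono_solution (eq_E k 3) 6 \<chi>"
  have col: "\<chi> i = \<chi> 2" if "i \<in> {2, 5, 6}" for i
    using that coloring_six[OF \<chi> _ no] by auto
  have none: "\<not> eq_E k 3 x y z w"
    if "x \<in> {2, 5, 6}" "y \<in> {2, 5, 6}" "z \<in> {2, 5, 6}" "w \<in> {2, 5, 6}"
    for x y z w
    by (rule no_mono_solution[OF no _ col that]) simp
  then show False
    \<comment> \<open>For \<open>z = 6\<close> and \<open>w = 5\<close> the equation reads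
      \<open>k = 15 - x - y\<close>, which is 8 and then 11.\<close>
    using assms none[of 2 5 6 5] none[of 2 2 6 5]
    by (auto simp: eq_E_def)
qed

definition extremal_coloring :: "nat \<Rightarrow> nat" where
  "extremal_coloring i = (if i \<in> {1, 3, 4, 7} then 0 else 1)"

text \<open>The quotient is the only candidate for \<open>k\<close>; for \<open>z = w\<close> it is \<open>0\<close> by convention, hence not positive.\<close>

lemma extremal_class_quotients:
  "\<forall>S\<in>{{1, 3, 4, 7}, {2, 5, 6, 8::int}}. \<forall>x\<in>S. \<forall>y\<in>S. \<forall>z\<in>S. \<forall>w\<in>S.
     (z = w \<longrightarrow> x + y \<noteq> 3 * w) \<and>
     ((z - w) dvd (3 * w - x - y) \<and> 0 < (3 * w - x - y) div (z - w) \<longrightarrow>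
       (3 * w - x - y) div (z - w) \<in> {1, 2, 3, 4, 5, 7, 8, 11} \<and>
       (if (3 * w - x - y) div (z - w) \<in> {8, 11} then 6 else 4) \<le> Max {x, y, z, w})"
  by code_simp

text \<open>Read contrapositively, the three clauses are the lower bounds: this one coloring has no
  monochromatic solution on \<open>{1..3}\<close> for any positive \<open>k\<close>, on
  \<open>{1..8}\<close> for \<open>k\<close> outside the list, or on \<open>{1..5}\<close> for
  \<open>k\<close> = 8, 11.\<close>

lemma extremal_coloring_solution:
  assumes "has_mono_solution (eq_E k 3) N extremal_coloring" "0 < k" "N \<le> 8"
  shows "4 \<le> N" "k \<in> {1, 2, 3, 4, 5, 7, 8, 11}" "k \<in> {8, 11} \<Longrightarrow> 6 \<le> N"
proof -
  obtain x y z w where range: "{x, y, z, w} \<subseteq> {1..N}"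
    and eq: "eq_E k 3 x y z w"
    and mono: "extremal_coloring x = extremal_coloring y" "extremal_coloring y = extremal_coloring z"
      "extremal_coloring z = extremal_coloring w"
    using assms(1) unfolding has_mono_solution_def by blast
  \<comment> \<open>The coloring is constantly 1 beyond 8, so this bound is what cuts its second
    class down to \<open>{2, 5, 6, 8}\<close>.\<close>
  have small: "{x, y, z, w} \<subseteq> {1, 2, 3, 4, 5, 6, 7, 8}"
    using range assms(3) by auto
  have "{x, y, z, w} \<subseteq> {1, 3, 4, 7} \<or> {x, y, z, w} \<subseteq> {2, 5, 6, 8}"
  proof (cases "w \<in> {1, 3, 4, 7}")
    case True
    then have "\<forall>i\<in>{x, y, z, w}. extremal_coloring i = 0"
      using mono by (simp add: extremal_coloring_def)
    then show ?thesis
      by (auto simp: extremal_coloring_def split: if_splits)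
  next
    case False
    then have "\<forall>i\<in>{x, y, z, w}. extremal_coloring i = 1"
      using mono by (simp add: extremal_coloring_def)
    then have "{x, y, z, w} \<inter> {1, 3, 4, 7} = {}"
      by (auto simp: extremal_coloring_def)
    then show ?thesis
      using small by blast
  qed
  \<comment> \<open>The quotients are taken over the integers because \<open>z - w\<close> and
    \<open>3 * w - x - y\<close> may both be negative.\<close>
  then have "int ` {x, y, z, w} \<subseteq> int ` {1, 3, 4, 7} \<or> int ` {x, y, z, w} \<subseteq> int ` {2, 5, 6, 8}"
    by blast
  then have "\<exists>S\<in>{{1, 3, 4, 7}, {2, 5, 6, 8}}. int x \<in> S \<and> int y \<in> S \<and> int z \<in> S \<and> int w \<in> S"
    by simp
  then obtain S where S: "S \<in> {{1, 3, 4, 7}, {2, 5, 6, 8}}"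
    "int x \<in> S" "int y \<in> S" "int z \<in> S" "int w \<in> S"
    by (elim bexE conjE)
  note quot = bspec[OF bspec[OF bspec[OF bspec[OF bspec[OF extremal_class_quotients
    S(1)] S(2)] S(3)] S(4)] S(5)]
  have k: "3 * int w - int x - int y = int k * (int z - int w)"
    using eq unfolding eq_E_def by (simp add: algebra_simps)
  \<comment> \<open>Equality would give \<open>x + y = 3 * w\<close>, which neither class
    allows.\<close>
  have "int z \<noteq> int w"
    using quot k by auto
  then have "(3 * int w - int x - int y) div (int z - int w) = int k"
    using k by simp
  moreover have "(int z - int w) dvd (3 * int w - int x - int y)"
    using k by simp
  ultimately have concl: "int k \<in> {1, 2, 3, 4, 5, 7, 8, 11}"
    "(if int k \<in> {8, 11} then 6 else 4) \<le> Max {int x, int y, int z, int w}"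
    using quot assms(2) by simp_all
  have "Max {int x, int y, int z, int w} \<le> int N"
    using range by simp
  then have N: "(if int k \<in> {8, 11} then 6 else 4) \<le> int N"
    using concl(2) by linarith
  show "k \<in> {1, 2, 3, 4, 5, 7, 8, 11}"
    using concl(1) by simp
  show "4 \<le> N"
    using N by (simp split: if_splits)
  show "6 \<le> N" if "k \<in> {8, 11}"
    using N that by auto
qed

theorem theorem5:
  fixes k :: nat
  assumes "k > 0"
  shows "(k \<le> 5 \<or> k = 7 \<longrightarrow> RR (eq_E k 3) = 4) \<and>
         (k \<in> {8, 11} \<longrightarrow> RR (eq_E k 3) = 6) \<and>
         (k \<in> {6, 9, 10} \<or> k \<ge> 12 \<longrightarrow> RR (eq_E k 3) = 9)"
proof -
  have col: "extremal_coloring i \<in> {0, 1}" for i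
    by (simp add: extremal_coloring_def)
  note sol = extremal_coloring_solution[OF _ assms]
  have RR: "RR (eq_E k 3) = enat n"
    if "0 < n" "forces_mono (eq_E k 3) n"
      "\<not> has_mono_solution (eq_E k 3) (n - 1) extremal_coloring" for n
    using RR_eqI[OF that(1,2) col that(3)] .
  show ?thesis
  proof (intro conjI impI)
    assume "k \<le> 5 \<or> k = 7"
    then have "k \<in> {1, 2, 3, 4, 5, 7}"
      using assms by auto
    moreover have "\<not> has_mono_solution (eq_E k 3) (4 - 1) extremal_coloring"
      using sol(1)[of 3] by auto
    ultimately show "RR (eq_E k 3) = 4"
      using RR[of 4] forces_mono_four by (simp add: numeral_eq_enat)
  next
    assume k: "k \<in> {8, 11}"
    then have "\<not> has_mono_solution (eq_E k 3) (6 - 1) extremal_coloring"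
      using sol(3)[of 5] by auto
    then show "RR (eq_E k 3) = 6"
      using RR[of 6] forces_mono_six[OF k] by (simp add: numeral_eq_enat)
  next
    assume "k \<in> {6, 9, 10} \<or> k \<ge> 12"
    then have "\<not> has_mono_solution (eq_E k 3) (9 - 1) extremal_coloring"
      using sol(2)[of 8] by auto
    then show "RR (eq_E k 3) = 9"
      using RR[of 9] forces_mono_nine by (simp add: numeral_eq_enat)
  qed
qed

end
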